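(* Let $u>0$ and let $X_1,\ldots,X_d$ be comonotonic positive integrable risks with continuous, increasing distribution functions $F_{X_1},\ldots,F_{X_d}$ and supports containing $[0,u]$ (so that each $F_{X_i}$ is strictly increasing on $[0,u]$). Then the optimal allocations of $u$ for the indicators $I$, $J$ and $I_{loc}$ (their minimizers over $\mathcal{U}^d_u$) coincide, and they are given by $(u_1,\ldots,u_d)\in\mathcal{U}^d_u$ and $$F_{X_i}(u_i)=F_{X_j}(u_j)\qquad \forall\, i,j=1,\ldots,d .$$
   Context: Let $d\ge2$, $S=\sum_{i=1}^d X_i$ and $\mathcal{U}^d_u=\{v=(v_1,\ldots,v_d)\in[0,u]^d:\ \sum_{i=1}^d v_i=u\}$. For $(u_1,\ldots,u_d)\in\mathcal{U}^d_u$ the indicators are $$I(u_1,\ldots,u_d)=\sum_{k=1}^d \mathbb{E}\big[(X_k-u_k)^+\mathbf 1_{\{S\le u\}}\big],\quad J(u_1,\ldots,u_d)=\sum_{k=1}^d \mathbb{E}\big[(X_k-u_k)^+\mathbf 1_{\{S\ge u\}}\big],\quad I_{loc}(u_1,\ldots,u_d)=\sum_{k=1}^d \mathbb{E}\big[(X_k-u_k)^+\big].$$ A random vector $(X_1,\ldots,X_d)$ is comonotonic if there exist a random variable $Y$ and non-decreasing functions $\varphi_1,\ldots,\varphi_d$ such that $(X_1,\ldots,X_d)$ has the same law as $(\varphi_1(Y),\ldots,\varphi_d(Y))$; equivalently, one may take $X_i=F_{X_i}^{-1}(U)$ with $U$ uniform on $[0,1]$. *)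

theory Defs
  imports "HOL-Probability.Probability"
begin

definition law :: "'a measure \<Rightarrow> ('a \<Rightarrow> 'b::topological_space) \<Rightarrow> 'b measure" where
  "law M X = distr M borel X"

text \<open>The topological support of a measure: the points all of whose open neighbourhoods
  have positive mass.\<close>

definition msupport :: "'b::topological_space measure \<Rightarrow> 'b set" where
  "msupport N = {x. \<forall>V. open V \<and> x \<in> V \<longrightarrow> emeasure N V > 0}"

text \<open>The equality in law lets \<open>Y\<close> live on a probability space other than the one of \<open>X\<close>.
  Since \<open>Y\<close> is real-valued, that space may be taken on the type of reals without loss of
  generality: replace it by the law of \<open>Y\<close>, and \<open>Y\<close> by the identity.\<close>

definition comonotonic :: "'a measure \<Rightarrow> ('a \<Rightarrow> real ^ 'd::finite) \<Rightarrow> bool" where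
  "comonotonic M X \<longleftrightarrow>
     (\<exists>(N :: real measure) (Y :: real \<Rightarrow> real) (\<phi> :: 'd \<Rightarrow> real \<Rightarrow> real).
        prob_space N \<and> Y \<in> borel_measurable N \<and> (\<forall>i. mono (\<phi> i)) \<and>
        law M X = law N (\<lambda>\<omega>. \<chi> i. \<phi> i (Y \<omega>)))"

definition allocations :: "real \<Rightarrow> (real ^ 'd::finite) set" where
  "allocations u = {v. (\<forall>i. v $ i \<in> {0..u}) \<and> (\<Sum>i\<in>UNIV. v $ i) = u}"

definition aggregate :: "('a \<Rightarrow> real ^ 'd::finite) \<Rightarrow> 'a \<Rightarrow> real" where
  "aggregate X \<omega> = (\<Sum>i\<in>UNIV. X \<omega> $ i)"

definition indicator_I :: "'a measure \<Rightarrow> ('a \<Rightarrow> real ^ 'd::finite) \<Rightarrow> real \<Rightarrow> real ^ 'd \<Rightarrow> real" where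
  "indicator_I M X u v =
     (\<Sum>k\<in>UNIV. \<integral>\<omega>. max (X \<omega> $ k - v $ k) 0 * indicator {\<omega>. aggregate X \<omega> \<le> u} \<omega> \<partial>M)"

definition indicator_J :: "'a measure \<Rightarrow> ('a \<Rightarrow> real ^ 'd::finite) \<Rightarrow> real \<Rightarrow> real ^ 'd \<Rightarrow> real" where
  "indicator_J M X u v =
     (\<Sum>k\<in>UNIV. \<integral>\<omega>. max (X \<omega> $ k - v $ k) 0 * indicator {\<omega>. aggregate X \<omega> \<ge> u} \<omega> \<partial>M)"

definition indicator_loc :: "'a measure \<Rightarrow> ('a \<Rightarrow> real ^ 'd::finite) \<Rightarrow> real ^ 'd \<Rightarrow> real" where
  "indicator_loc M X v = (\<Sum>k\<in>UNIV. \<integral>\<omega>. max (X \<omega> $ k - v $ k) 0 \<partial>M)"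

definition optimal_allocations :: "real \<Rightarrow> (real ^ 'd::finite \<Rightarrow> real) \<Rightarrow> (real ^ 'd) set" where
  "optimal_allocations u f = {v. is_arg_min f (\<lambda>w. w \<in> allocations u) v}"

end

theory Submission
  imports Defs
begin

text \<open>Let \<open>v\<close> be an allocation at which all the \<open>F i (v $ i)\<close> have the same value.  By
  comonotonicity any two of the events \<open>X $ i \<le> v $ i\<close> and \<open>X $ j \<le> v $ j\<close> are nested up to a
  null set, and they have the same probability, so they agree almost surely.  The marginals have
  no atoms, hence almost surely either every risk stays strictly below its share of the capital
  or every risk strictly exceeds it (lemma \<open>comonotonic_separation\<close>).

  In the first case all the shortfalls \<open>max (X $ k - v $ k) 0\<close> vanish; in the second they add up to
  the excess of the aggregate over \<open>u\<close>, which is a lower bound for the total shortfall under any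
  allocation whatsoever.  So \<open>v\<close> minimises the total shortfall scenario by scenario, hence also
  after restriction to any event, in particular to \<open>S \<le> u\<close>, to \<open>S \<ge> u\<close> or to no event at all.
  Another allocation \<open>w\<close> gives less than \<open>v\<close> to some \<open>k\<close> and more to some \<open>l\<close>.  It does strictly
  worse when \<open>w $ k < X $ k < v $ k\<close>, where \<open>S < u\<close>, and when \<open>v $ l < X $ l < w $ l\<close>, where
  \<open>S > u\<close>; both events have positive probability because the supports contain \<open>[0, u]\<close>.  So \<open>v\<close>
  is the unique minimiser of each indicator (lemma \<open>separating_allocation_optimal\<close>), which also
  makes the allocation with equal levels unique.  It exists (lemma \<open>equal_level_allocation\<close>) because
  an allocation that maximises \<open>min\<^sub>i F i (v $ i)\<close> must equalise the levels: otherwise capital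
  could be moved from a risk with a higher level to all the risks, increasing the minimum.\<close>

section \<open>Allocations with equal levels\<close>

lemma compact_allocations: "compact (allocations u :: (real ^ 'd::finite) set)"
proof -
  have "allocations u
      = cbox (0::real^'d) (\<chi> i. u) \<inter> {v. (\<Sum>i\<in>UNIV. v $ i) = u}"
    by (auto simp: allocations_def mem_box_cart)
  moreover have "closed {v::real^'d. (\<Sum>i\<in>UNIV. v $ i) = u}"
    by (intro closed_Collect_eq continuous_intros)
  ultimately show ?thesis
    by (simp add: compact_Int_closed compact_cbox)
qed

lemma continuous_on_Min_image:
  fixes g :: "'i \<Rightarrow> 'a::topological_space \<Rightarrow> real"
  assumes "finite I" "I \<noteq> {}" "\<And>i. i \<in> I \<Longrightarrow> continuous_on S (g i)"
  shows "continuous_on S (\<lambda>x. Min ((\<lambda>i. g i x) ` I))"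
  using assms
proof (induction I rule: finite_ne_induct)
  case (insert i I)
  have "continuous_on S (\<lambda>x. min (g i x) (Min ((\<lambda>i. g i x) ` I)))"
    by (intro continuous_on_min insert.IH insert.prems) auto
  then show ?case
    using insert.hyps by (simp add: image_image)
qed simp

text \<open>Maximising the lowest level over the compact set of allocations avoids inverting
  the functions.\<close>

lemma equal_level_allocation:
  fixes F :: "'d::finite \<Rightarrow> real \<Rightarrow> real"
  assumes u: "0 \<le> u"
    and cont: "\<And>i. continuous_on {0..u} (F i)"
    and mono: "\<And>i. strict_mono_on {0..u} (F i)"
    and zero: "\<And>i. F i 0 = c"
  obtains v where "v \<in> allocations u" "\<And>i j. F i (v $ i) = F j (v $ j)"
proof -
  let ?A = "allocations u :: (real^'d) set"
  define m where "m = (\<lambda>v::real^'d. Min ((\<lambda>i. F i (v $ i)) ` UNIV))"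
  have m_le: "m w \<le> F i (w $ i)" for w i
    by (simp add: m_def)
  have m_greater: "a < m w" if "\<And>i. a < F i (w $ i)" for a w
    using that by (simp add: m_def)
  have box: "0 \<le> w $ i" "w $ i \<le> u" if "w \<in> ?A" for w i
    using that by (auto simp: allocations_def)
  have "continuous_on ?A m"
    unfolding m_def
  proof (rule continuous_on_Min_image)
    show "continuous_on ?A (\<lambda>v. F i (v $ i))" for i
      by (rule continuous_on_compose2[OF cont[of i]]) (auto intro!: continuous_intros simp: box)
  qed auto
  moreover have "?A \<noteq> {}"
  proof -
    fix i :: 'd
    have "(\<chi> j. if j = i then u else 0) \<in> ?A"
      using u by (auto simp: allocations_def)
    then show ?thesis by blast
  qed
  ultimately obtain v where v: "v \<in> ?A" and v_max: "\<And>w. w \<in> ?A \<Longrightarrow> m w \<le> m v"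
    using continuous_attains_sup[OF compact_allocations, of u m] by blast
  have "F i (v $ i) = m v" for i
  proof (rule ccontr)
    assume "F i (v $ i) \<noteq> m v"
    with m_le[of v i] have gt: "m v < F i (v $ i)"
      by simp
    \<comment> \<open>All levels start from the same value \<open>c\<close>, so a risk above the lowest level holds capital
      that can be taken away.\<close>
    have "F j 0 \<le> F j (v $ j)" for j
      using strict_mono_on_leD[OF mono[of j], of 0 "v $ j"] box[OF v, of j] u by auto
    then have "c \<le> F j (v $ j)" for j
      by (metis zero)
    then have "c \<le> m v"
      by (simp add: m_def)
    with gt zero[of i] have "v $ i \<noteq> 0"
      by auto
    with box(1)[OF v, of i] have pos: "0 < v $ i"
      by simp
    obtain \<delta> where \<delta>: "\<delta> > 0"
      and near: "\<And>x. x \<in> {0..u} \<Longrightarrow> dist x (v $ i) < \<delta> \<Longrightarrow> dist (F i x) (F i (v $ i)) < F i (v $ i) - m v"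
      using cont[of i] gt box[OF v, of i] unfolding continuous_on_iff
      by (metis atLeastAtMost_iff diff_gt_0_iff_gt)
    define \<epsilon> where "\<epsilon> = min (v $ i) (\<delta> / 2)"
    have \<epsilon>: "0 < \<epsilon>" "\<epsilon> \<le> v $ i" "\<epsilon> < \<delta>"
      using pos \<delta> by (auto simp: \<epsilon>_def)
    \<comment> \<open>Take \<open>\<epsilon>\<close> from \<open>i\<close> and share it equally among all the risks, \<open>i\<close> included.\<close>
    define w where "w = (\<chi> j. v $ j + \<epsilon> / CARD('d) - (if j = i then \<epsilon> else 0))"
    have share: "0 < \<epsilon> / CARD('d)"
      using \<epsilon> by simp
    have w_nonneg: "0 \<le> w $ j" for j
    proof (cases "j = i")
      case True
      then have "w $ j = (v $ i - \<epsilon>) + \<epsilon> / CARD('d)"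
        by (simp add: w_def)
      then show ?thesis
        using share \<epsilon> by linarith
    next
      case False
      then show ?thesis
        using box(1)[OF v, of j] share by (simp add: w_def)
    qed
    have w_sum: "(\<Sum>j\<in>UNIV. w $ j) = u"
      using v by (simp add: w_def sum.distrib sum_subtractf allocations_def)
    have w_le: "w $ j \<le> u" for j
      using member_le_sum[of j UNIV "\<lambda>j. w $ j"] w_nonneg w_sum by simp
    have w: "w \<in> ?A"
      using w_nonneg w_le w_sum by (simp add: allocations_def)
    have "m v < F j (w $ j)" for j
    proof (cases "j = i")
      case False
      then have "v $ j < w $ j"
        using share by (simp add: w_def)
      then have "F j (v $ j) < F j (w $ j)"
        using strict_mono_onD[OF mono[of j], of "v $ j" "w $ j"] box[OF v, of j] box[OF w, of j]
        by simp
      then show ?thesis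
        using m_le[of v j] by simp
    next
      case True
      have "dist (v $ i - \<epsilon>) (v $ i) < \<delta>" "v $ i - \<epsilon> \<in> {0..u}"
        using \<epsilon> box[OF v, of i] by (auto simp: dist_real_def)
      from near[OF this(2,1)] have "m v < F i (v $ i - \<epsilon>)"
        by (auto simp: dist_real_def)
      also have "\<dots> \<le> F i (w $ i)"
      proof (rule strict_mono_on_leD[OF mono[of i]])
        show "v $ i - \<epsilon> \<le> w $ i"
          using share by (simp add: w_def)
      qed (use \<epsilon> box[OF v, of i] box[OF w, of i] in auto)
      finally show ?thesis
        using True by simp
    qed
    then have "m v < m w"
      by (rule m_greater)
    with v_max[OF w] show False
      by simp
  qed
  then show ?thesis
    using that[OF v] by metis
qed

section \<open>The total shortfall in a single scenario\<close>

definition total_shortfall :: "real ^ 'd::finite \<Rightarrow> real ^ 'd \<Rightarrow> real" where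
  "total_shortfall w x = (\<Sum>k\<in>UNIV. max (x $ k - w $ k) 0)"

lemma total_shortfall_nonneg: "0 \<le> total_shortfall w x"
  by (simp add: total_shortfall_def sum_nonneg)

lemma total_shortfall_pos:
  assumes "w $ k < x $ k"
  shows "0 < total_shortfall w x"
  unfolding total_shortfall_def by (rule sum_pos2[where i = k]) (use assms in auto)

lemma total_shortfall_ge: "(\<Sum>k\<in>UNIV. x $ k) - (\<Sum>k\<in>UNIV. w $ k) \<le> total_shortfall w x"
  unfolding total_shortfall_def sum_subtractf[symmetric] by (rule sum_mono) auto

lemma total_shortfall_greater:
  assumes "x $ k < w $ k"
  shows "(\<Sum>k\<in>UNIV. x $ k) - (\<Sum>k\<in>UNIV. w $ k) < total_shortfall w x"
  unfolding total_shortfall_def sum_subtractf[symmetric]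
proof (rule sum_strict_mono_ex1)
  show "\<exists>k\<in>UNIV. x $ k - w $ k < max (x $ k - w $ k) 0"
    using assms by (intro bexI[of _ k]) auto
qed auto

lemma total_shortfall_all_below:
  assumes "\<And>i. x $ i < v $ i"
  shows "total_shortfall v x = 0"
proof -
  have "max (x $ k - v $ k) 0 = 0" for k
    using assms[of k] by simp
  then show ?thesis
    by (simp add: total_shortfall_def)
qed

lemma total_shortfall_all_above:
  assumes "\<And>i. v $ i < x $ i"
  shows "total_shortfall v x = (\<Sum>k\<in>UNIV. x $ k) - (\<Sum>k\<in>UNIV. v $ k)"
proof -
  have "max (x $ k - v $ k) 0 = x $ k - v $ k" for k
    using assms[of k] by simp
  then show ?thesis
    by (simp add: total_shortfall_def sum_subtractf)
qed

lemma total_shortfall_le: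
  assumes "(\<Sum>k\<in>UNIV. v $ k) = (\<Sum>k\<in>UNIV. w $ k)"
    and "(\<forall>i. x $ i < v $ i) \<or> (\<forall>i. v $ i < x $ i)"
  shows "total_shortfall v x \<le> total_shortfall w x"
  using assms(2)
proof
  assume "\<forall>i. x $ i < v $ i"
  then show ?thesis
    by (simp add: total_shortfall_all_below total_shortfall_nonneg)
next
  assume "\<forall>i. v $ i < x $ i"
  then show ?thesis
    using total_shortfall_ge[of x w] assms(1) by (simp add: total_shortfall_all_above)
qed

section \<open>Comonotonic risks at equal levels\<close>

lemma borel_measurable_vec_component [measurable]:
  fixes X :: "'a \<Rightarrow> real ^ 'd::finite"
  assumes "X \<in> borel_measurable M"
  shows "(\<lambda>\<omega>. X \<omega> $ i) \<in> borel_measurable M"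
  using assms borel_measurable_nth by (rule measurable_compose)

lemma emeasure_law:
  assumes "X \<in> borel_measurable M" "B \<in> sets borel"
  shows "emeasure (law M X) B = emeasure M {\<omega> \<in> space M. X \<omega> \<in> B}"
proof -
  have "X -` B \<inter> space M = {\<omega> \<in> space M. X \<omega> \<in> B}"
    by blast
  then show ?thesis
    using assms by (simp add: law_def emeasure_distr)
qed

text \<open>For a vector of non-decreasing functions of one variable \<open>y\<close>, one of the two events is even
  empty: points of both would be ordered in both directions.\<close>

lemma comonotonic_nested_null:
  fixes X :: "'a \<Rightarrow> real ^ 'd::finite"
  assumes X: "X \<in> borel_measurable M" and com: "comonotonic M X"
  shows "(AE \<omega> in M. X \<omega> $ i \<le> a \<longrightarrow> X \<omega> $ j \<le> b) \<or> (AE \<omega> in M. X \<omega> $ j \<le> b \<longrightarrow> X \<omega> $ i \<le> a)"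
proof -
  obtain N :: "real measure" and Y :: "real \<Rightarrow> real" and \<phi> :: "'d \<Rightarrow> real \<Rightarrow> real" where
    Y[measurable]: "Y \<in> borel_measurable N" and mono: "\<And>i. mono (\<phi> i)"
    and law: "law M X = law N (\<lambda>\<omega>. \<chi> i. \<phi> i (Y \<omega>))"
    using com unfolding comonotonic_def by blast
  have [measurable]: "\<phi> i \<in> borel_measurable borel" for i
    by (rule borel_measurable_mono[OF mono])
  have vec: "(\<lambda>\<omega>. \<chi> i. \<phi> i (Y \<omega>)) \<in> borel_measurable N"
  proof (rule borel_measurable_euclidean_space[THEN iffD2], rule ballI)
    fix b :: "real ^ 'd"
    assume "b \<in> Basis"
    then obtain i where "b = axis i 1"
      by (auto simp: Basis_vec_def)
    then have "(\<lambda>\<omega>. (\<chi> i. \<phi> i (Y \<omega>)) \<bullet> b) = (\<lambda>\<omega>. \<phi> i (Y \<omega>))"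
      by (simp add: inner_axis)
    then show "(\<lambda>\<omega>. (\<chi> i. \<phi> i (Y \<omega>)) \<bullet> b) \<in> borel_measurable N"
      by simp
  qed
  have AE: "AE \<omega> in M. X \<omega> $ k \<le> s \<longrightarrow> X \<omega> $ l \<le> t"
    if empty: "\<And>y. \<phi> k y \<le> s \<Longrightarrow> \<phi> l y \<le> t" for k l s t
  proof -
    let ?B = "{x :: real^'d. x $ k \<le> s \<and> t < x $ l}"
    have B: "?B \<in> sets borel"
      by measurable
    have "{\<omega> \<in> space N. (\<chi> i. \<phi> i (Y \<omega>)) \<in> ?B} = {}"
      using empty by (auto simp: not_less[symmetric])
    then have "emeasure (law M X) ?B = 0"
      unfolding law emeasure_law[OF vec B] by (simp only: emeasure_empty)
    then have "emeasure M {\<omega> \<in> space M. X \<omega> \<in> ?B} = 0"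
      by (simp only: emeasure_law[OF X B])
    moreover have "{\<omega> \<in> space M. X \<omega> \<in> ?B} \<in> sets M"
      using X B by measurable
    ultimately show ?thesis
      by (subst AE_iff_measurable[OF _ refl]) (auto simp: not_le)
  qed
  have "(\<forall>y. \<phi> i y \<le> a \<longrightarrow> \<phi> j y \<le> b) \<or> (\<forall>y. \<phi> j y \<le> b \<longrightarrow> \<phi> i y \<le> a)"
  proof (rule ccontr)
    assume "\<not> ?thesis"
    then obtain y y' where y: "\<phi> i y \<le> a" "b < \<phi> j y" "\<phi> j y' \<le> b" "a < \<phi> i y'"
      by (auto simp: not_le)
    show False
      using monoD[OF mono[of i], of y' y] monoD[OF mono[of j], of y y'] y by linarith
  qed
  then show ?thesis
    using AE by blast
qed

lemma (in finite_measure) AE_iff_of_AE_imp_measure_eq: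
  assumes imp: "AE \<omega> in M. P \<omega> \<longrightarrow> Q \<omega>"
    and [measurable]: "Measurable.pred M P" "Measurable.pred M Q"
    and eq: "measure M {\<omega> \<in> space M. P \<omega>} = measure M {\<omega> \<in> space M. Q \<omega>}"
  shows "AE \<omega> in M. P \<omega> \<longleftrightarrow> Q \<omega>"
proof -
  let ?P = "{\<omega> \<in> space M. P \<omega>}" and ?Q = "{\<omega> \<in> space M. Q \<omega>}"
  have "measure M (?Q \<inter> ?P) = measure M ?P"
    by (rule finite_measure_eq_AE) (use imp in auto)
  then have "measure M (?Q - ?P) = 0"
    using finite_measure_Diff'[of ?Q ?P] eq by simp
  then have "?Q - ?P \<in> null_sets M"
    by (simp add: null_sets_def emeasure_eq_measure)
  then have "AE \<omega> in M. \<omega> \<notin> ?Q - ?P"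
    by (rule AE_not_in)
  with imp show ?thesis
    by (auto elim: AE_mp)
qed

lemma (in prob_space) cdf_law:
  assumes "Z \<in> borel_measurable M"
  shows "cdf (law M Z) a = prob {\<omega> \<in> space M. Z \<omega> \<le> a}"
proof -
  have "Z -` {..a} \<inter> space M = {\<omega> \<in> space M. Z \<omega> \<le> a}"
    by auto
  then show ?thesis
    using assms by (simp add: cdf_def law_def measure_distr)
qed

lemma (in prob_space) AE_neq_of_continuous_cdf:
  fixes Z :: "'a \<Rightarrow> real"
  assumes Z: "Z \<in> borel_measurable M" and cont: "continuous_on UNIV (cdf (law M Z))"
  shows "AE \<omega> in M. Z \<omega> \<noteq> a"
proof -
  interpret L: real_distribution "law M Z"
    unfolding law_def using Z by simp
  have "measure (law M Z) {a} = 0"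
    using cont L.isCont_cdf[of a] by (simp add: continuous_on_eq_continuous_at)
  then have "AE x in law M Z. x \<noteq> a"
    by (subst AE_iff_measurable[OF _ refl]) (auto simp: L.emeasure_eq_measure)
  then show ?thesis
    unfolding law_def using Z by (subst (asm) AE_distr_iff) auto
qed

text \<open>Equal probabilities turn the almost sure inclusion into almost sure equality, for each of
  the finitely many pairs of indices; the absence of atoms makes the inequalities strict.\<close>

lemma (in prob_space) comonotonic_separation:
  fixes X :: "'a \<Rightarrow> real ^ 'd::finite"
  assumes X[measurable]: "X \<in> borel_measurable M" and com: "comonotonic M X"
    and cont: "\<And>i. continuous_on UNIV (cdf (law M (\<lambda>\<omega>. X \<omega> $ i)))"
    and level: "\<And>i j. cdf (law M (\<lambda>\<omega>. X \<omega> $ i)) (v $ i) = cdf (law M (\<lambda>\<omega>. X \<omega> $ j)) (v $ j)"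
  shows "AE \<omega> in M. (\<forall>i. X \<omega> $ i < v $ i) \<or> (\<forall>i. v $ i < X \<omega> $ i)"
proof -
  have eq: "prob {\<omega> \<in> space M. X \<omega> $ i \<le> v $ i} = prob {\<omega> \<in> space M. X \<omega> $ j \<le> v $ j}" for i j
    using level[of i j] by (simp add: cdf_law)
  have "AE \<omega> in M. X \<omega> $ i \<le> v $ i \<longleftrightarrow> X \<omega> $ j \<le> v $ j" for i j
    using comonotonic_nested_null[OF X com, of i "v $ i" j "v $ j"]
  proof
    assume "AE \<omega> in M. X \<omega> $ i \<le> v $ i \<longrightarrow> X \<omega> $ j \<le> v $ j"
    then show ?thesis
      by (rule AE_iff_of_AE_imp_measure_eq) (use eq in auto)
  next
    assume "AE \<omega> in M. X \<omega> $ j \<le> v $ j \<longrightarrow> X \<omega> $ i \<le> v $ i"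
    then have "AE \<omega> in M. X \<omega> $ j \<le> v $ j \<longleftrightarrow> X \<omega> $ i \<le> v $ i"
      by (rule AE_iff_of_AE_imp_measure_eq) (use eq in auto)
    then show ?thesis
      by (rule AE_mp) auto
  qed
  then have "AE \<omega> in M. \<forall>i\<in>UNIV. \<forall>j\<in>UNIV. X \<omega> $ i \<le> v $ i \<longleftrightarrow> X \<omega> $ j \<le> v $ j"
    by (intro AE_finite_allI) auto
  moreover have "AE \<omega> in M. \<forall>i\<in>UNIV. X \<omega> $ i \<noteq> v $ i"
    by (intro AE_finite_allI AE_neq_of_continuous_cdf cont) auto
  ultimately show ?thesis
  proof eventually_elim
    case (elim \<omega>)
    show ?case
    proof (rule disjCI)
      assume "\<not> (\<forall>i. v $ i < X \<omega> $ i)"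
      then obtain j where "X \<omega> $ j \<le> v $ j"
        by (auto simp: not_less)
      with elim show "\<forall>i. X \<omega> $ i < v $ i"
        by (auto simp: less_le)
    qed
  qed
qed

section \<open>Optimality of a separating allocation\<close>

text \<open>All three indicators have this form: \<open>T\<close> is \<open>{..u}\<close> for \<open>I\<close>, \<open>{u..}\<close> for \<open>J\<close> and the whole
  line for the local indicator.\<close>

definition restricted_indicator ::
    "'a measure \<Rightarrow> ('a \<Rightarrow> real ^ 'd::finite) \<Rightarrow> real set \<Rightarrow> real ^ 'd \<Rightarrow> real" where
  "restricted_indicator M X T w =
     (\<Sum>k\<in>UNIV. \<integral>\<omega>. max (X \<omega> $ k - w $ k) 0 * indicator T (aggregate X \<omega>) \<partial>M)"

lemma indicator_I_eq: "indicator_I M X u = restricted_indicator M X {..u}"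
  by (auto simp: fun_eq_iff indicator_I_def restricted_indicator_def indicator_def)

lemma indicator_J_eq: "indicator_J M X u = restricted_indicator M X {u..}"
  by (auto simp: fun_eq_iff indicator_J_def restricted_indicator_def indicator_def)

lemma indicator_loc_eq: "indicator_loc M X = restricted_indicator M X UNIV"
  by (auto simp: fun_eq_iff indicator_loc_def restricted_indicator_def)

lemma (in prob_space) restricted_indicator_eq_integral:
  fixes X :: "'a \<Rightarrow> real ^ 'd::finite"
  assumes X[measurable]: "X \<in> borel_measurable M" and int: "\<And>i. integrable M (\<lambda>\<omega>. X \<omega> $ i)"
    and T[measurable]: "T \<in> sets borel"
  shows "integrable M (\<lambda>\<omega>. total_shortfall w (X \<omega>) * indicator T (aggregate X \<omega>))"
    and "restricted_indicator M X T w
      = (\<integral>\<omega>. total_shortfall w (X \<omega>) * indicator T (aggregate X \<omega>) \<partial>M)"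
proof -
  have [measurable]: "aggregate X \<in> borel_measurable M"
    unfolding aggregate_def by measurable
  have int': "integrable M (\<lambda>\<omega>. max (X \<omega> $ k - w $ k) 0 * indicator T (aggregate X \<omega>))" for k
  proof (rule Bochner_Integration.integrable_bound)
    show "integrable M (\<lambda>\<omega>. X \<omega> $ k - w $ k)"
      by (intro Bochner_Integration.integrable_diff int) simp
  qed (auto simp: indicator_def)
  show "integrable M (\<lambda>\<omega>. total_shortfall w (X \<omega>) * indicator T (aggregate X \<omega>))"
    unfolding total_shortfall_def sum_distrib_right
    by (intro Bochner_Integration.integrable_sum int')
  show "restricted_indicator M X T w
      = (\<integral>\<omega>. total_shortfall w (X \<omega>) * indicator T (aggregate X \<omega>) \<partial>M)"
    unfolding restricted_indicator_def total_shortfall_def sum_distrib_right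
    by (rule Bochner_Integration.integral_sum[symmetric]) (rule int')
qed

lemma (in prob_space) emeasure_open_interval_pos:
  fixes Z :: "'a \<Rightarrow> real"
  assumes Z: "Z \<in> borel_measurable M" and supp: "{0..u} \<subseteq> msupport (law M Z)"
    and ab: "0 \<le> a" "a < b" "b \<le> u"
  shows "0 < emeasure M {\<omega> \<in> space M. a < Z \<omega> \<and> Z \<omega> < b}"
proof -
  have "(a + b) / 2 \<in> msupport (law M Z)"
    using supp ab by (intro subsetD[OF supp]) auto
  then have "0 < emeasure (law M Z) {a<..<b}"
    using ab by (auto simp: msupport_def)
  then show ?thesis
    using Z by (simp add: emeasure_law)
qed

lemma exists_component_less:
  fixes v w :: "real ^ 'd::finite"
  assumes sum: "(\<Sum>k\<in>UNIV. v $ k) = (\<Sum>k\<in>UNIV. w $ k)" and neq: "v \<noteq> w"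
  shows "\<exists>k. w $ k < v $ k"
proof (rule ccontr)
  assume "\<not> ?thesis"
  then have "v $ i \<le> w $ i" for i
    by (simp add: not_less)
  then have "v $ i = w $ i" for i
    using sum_mono_inv[OF sum, of i] by simp
  with neq show False
    by (simp add: vec_eq_iff)
qed

text \<open>One-sided knowledge of \<open>T\<close> suffices, because strict inequality between the shortfalls
  occurs on both sides of \<open>u\<close>.\<close>

lemma (in prob_space) separating_allocation_strict:
  fixes X :: "'a \<Rightarrow> real ^ 'd::finite"
  assumes X[measurable]: "X \<in> borel_measurable M" and int: "\<And>i. integrable M (\<lambda>\<omega>. X \<omega> $ i)"
    and supp: "\<And>i. {0..u} \<subseteq> msupport (law M (\<lambda>\<omega>. X \<omega> $ i))"
    and v: "v \<in> allocations u" and w: "w \<in> allocations u" and neq: "w \<noteq> v"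
    and sep: "AE \<omega> in M. (\<forall>i. X \<omega> $ i < v $ i) \<or> (\<forall>i. v $ i < X \<omega> $ i)"
    and T: "T \<in> sets borel" "{..<u} \<subseteq> T \<or> {u<..} \<subseteq> T"
  shows "restricted_indicator M X T v < restricted_indicator M X T w"
proof -
  have sums: "(\<Sum>k\<in>UNIV. v $ k) = u" "(\<Sum>k\<in>UNIV. w $ k) = u"
    and box: "0 \<le> v $ i" "v $ i \<le> u" "0 \<le> w $ i" "w $ i \<le> u" for i
    using v w by (auto simp: allocations_def)
  let ?h = "\<lambda>w \<omega>. total_shortfall w (X \<omega>) * indicator T (aggregate X \<omega>) :: real"
  have le: "AE \<omega> in M. ?h v \<omega> \<le> ?h w \<omega>"
    using sep by eventually_elim (auto intro!: mult_right_mono total_shortfall_le simp: sums)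
  have below: "aggregate X \<omega> < u" if "\<forall>i. X \<omega> $ i < v $ i" for \<omega>
    unfolding aggregate_def sums(1)[symmetric] by (rule sum_strict_mono) (use that in auto)
  have above: "u < aggregate X \<omega>" if "\<forall>i. v $ i < X \<omega> $ i" for \<omega>
    unfolding aggregate_def sums(1)[symmetric] by (rule sum_strict_mono) (use that in auto)
  obtain k where k: "w $ k < v $ k"
    using exists_component_less[of v w] sums neq by auto
  obtain l where l: "v $ l < w $ l"
    using exists_component_less[of w v] sums neq by auto
  obtain A where A: "emeasure M A \<noteq> 0" "A \<in> sets M"
    and strict: "AE \<omega> in M. \<omega> \<in> A \<longrightarrow> ?h v \<omega> \<noteq> ?h w \<omega>"
    using T(2)
  proof
    assume T_below: "{..<u} \<subseteq> T"
    let ?A = "{\<omega> \<in> space M. w $ k < X \<omega> $ k \<and> X \<omega> $ k < v $ k}"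
    show thesis
    proof (rule that[of ?A])
      show "emeasure M ?A \<noteq> 0"
        using emeasure_open_interval_pos[OF _ supp[of k], of "w $ k" "v $ k"] k box by simp
      show "?A \<in> sets M"
        by measurable
      show "AE \<omega> in M. \<omega> \<in> ?A \<longrightarrow> ?h v \<omega> \<noteq> ?h w \<omega>"
        using sep
      proof eventually_elim
        case (elim \<omega>)
        show ?case
        proof
          assume A: "\<omega> \<in> ?A"
          then have all: "\<forall>i. X \<omega> $ i < v $ i"
            using elim by (auto dest: less_asym)
          then have "aggregate X \<omega> \<in> T"
            using below T_below by blast
          then show "?h v \<omega> \<noteq> ?h w \<omega>"
            using total_shortfall_all_below[of "X \<omega>" v] total_shortfall_pos[of w k "X \<omega>"] all A
            by simp
        qed
      qed
    qed
  next
    assume T_above: "{u<..} \<subseteq> T"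
    let ?A = "{\<omega> \<in> space M. v $ l < X \<omega> $ l \<and> X \<omega> $ l < w $ l}"
    show thesis
    proof (rule that[of ?A])
      show "emeasure M ?A \<noteq> 0"
        using emeasure_open_interval_pos[OF _ supp[of l], of "v $ l" "w $ l"] l box by simp
      show "?A \<in> sets M"
        by measurable
      show "AE \<omega> in M. \<omega> \<in> ?A \<longrightarrow> ?h v \<omega> \<noteq> ?h w \<omega>"
        using sep
      proof eventually_elim
        case (elim \<omega>)
        show ?case
        proof
          assume A: "\<omega> \<in> ?A"
          then have all: "\<forall>i. v $ i < X \<omega> $ i"
            using elim by (auto dest: less_asym)
          then have "aggregate X \<omega> \<in> T"
            using above T_above by blast
          then show "?h v \<omega> \<noteq> ?h w \<omega>"
            using total_shortfall_all_above[of v "X \<omega>"] total_shortfall_greater[of "X \<omega>" l w] all A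
            by (simp add: sums)
        qed
      qed
    qed
  qed
  show ?thesis
    unfolding restricted_indicator_eq_integral(2)[OF X int T(1)]
    by (rule integral_less_AE[OF _ _ A strict le])
      (rule restricted_indicator_eq_integral(1)[OF X int T(1)])+
qed

lemma optimal_allocations_eq_singleton:
  assumes "v \<in> allocations u" "\<And>w. w \<in> allocations u \<Longrightarrow> w \<noteq> v \<Longrightarrow> f v < f w"
  shows "optimal_allocations u f = {v}"
proof -
  have "is_arg_min f (\<lambda>w. w \<in> allocations u) w \<longleftrightarrow> w = v" for w
    using assms unfolding is_arg_min_def by (metis less_asym less_irrefl)
  then show ?thesis
    by (simp add: optimal_allocations_def)
qed

lemma (in prob_space) separating_allocation_optimal:
  fixes X :: "'a \<Rightarrow> real ^ 'd::finite"
  assumes "X \<in> borel_measurable M" "\<And>i. integrable M (\<lambda>\<omega>. X \<omega> $ i)"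
    and "\<And>i. {0..u} \<subseteq> msupport (law M (\<lambda>\<omega>. X \<omega> $ i))"
    and "v \<in> allocations u"
    and "AE \<omega> in M. (\<forall>i. X \<omega> $ i < v $ i) \<or> (\<forall>i. v $ i < X \<omega> $ i)"
    and "T \<in> sets borel" "{..<u} \<subseteq> T \<or> {u<..} \<subseteq> T"
  shows "optimal_allocations u (restricted_indicator M X T) = {v}"
  using assms by (intro optimal_allocations_eq_singleton separating_allocation_strict)

section \<open>The allocation with equal levels is optimal\<close>

lemma (in prob_space) cdf_law_strict_mono_on:
  fixes Z :: "'a \<Rightarrow> real"
  assumes Z[measurable]: "Z \<in> borel_measurable M" and supp: "{0..u} \<subseteq> msupport (law M Z)"
  shows "strict_mono_on {0..u} (cdf (law M Z))"
proof (rule strict_mono_onI)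
  fix a b :: real
  assume ab: "a \<in> {0..u}" "b \<in> {0..u}" "a < b"
  let ?A = "{\<omega> \<in> space M. Z \<omega> \<le> a}" and ?D = "{\<omega> \<in> space M. a < Z \<omega> \<and> Z \<omega> < b}"
  have "prob ?A + prob ?D = prob (?A \<union> ?D)"
    by (rule finite_measure_Union[symmetric]) auto
  also have "\<dots> \<le> prob {\<omega> \<in> space M. Z \<omega> \<le> b}"
    by (rule finite_measure_mono) (use ab in auto)
  finally show "cdf (law M Z) a < cdf (law M Z) b"
    using emeasure_open_interval_pos[OF Z supp, of a b] ab
    by (simp add: cdf_law[OF Z] emeasure_eq_measure)
qed

theorem proposition3p5:
  fixes M :: "'a measure" and X :: "'a \<Rightarrow> real ^ 'd::finite" and u :: real
    and F :: "'d \<Rightarrow> real \<Rightarrow> real"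
  defines "F \<equiv> (\<lambda>i. cdf (law M (\<lambda>\<omega>. X \<omega> $ i)))"
  assumes "CARD('d) \<ge> 2"
    and "u > 0"
    and "prob_space M"
    and "X \<in> borel_measurable M"
    and "comonotonic M X"
    and "\<And>i. AE \<omega> in M. X \<omega> $ i > 0"
    and "\<And>i. integrable M (\<lambda>\<omega>. X \<omega> $ i)"
    and "\<And>i. continuous_on UNIV (F i)"
    and "\<And>i. mono (F i)"
    and "\<And>i. {0..u} \<subseteq> msupport (law M (\<lambda>\<omega>. X \<omega> $ i))"
  shows "optimal_allocations u (indicator_I M X u)
           = {v \<in> allocations u. \<forall>i j. F i (v $ i) = F j (v $ j)}
       \<and> optimal_allocations u (indicator_J M X u)
           = {v \<in> allocations u. \<forall>i j. F i (v $ i) = F j (v $ j)}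
       \<and> optimal_allocations u (indicator_loc M X)
           = {v \<in> allocations u. \<forall>i j. F i (v $ i) = F j (v $ j)}
       \<and> {v \<in> allocations u. \<forall>i j. F i (v $ i) = F j (v $ j)} \<noteq> {}"
proof -
  interpret prob_space M by fact
  note X[measurable] = \<open>X \<in> borel_measurable M\<close>
  have comp[measurable]: "(\<lambda>\<omega>. X \<omega> $ i) \<in> borel_measurable M" for i
    by measurable
  let ?E = "{v \<in> allocations u. \<forall>i j. F i (v $ i) = F j (v $ j)}"
  have optimal: "optimal_allocations u (restricted_indicator M X T) = {v}"
    if "v \<in> ?E" "T \<in> sets borel" "{..<u} \<subseteq> T \<or> {u<..} \<subseteq> T" for v T
  proof (rule separating_allocation_optimal[OF X assms(8,11)])
    show "AE \<omega> in M. (\<forall>i. X \<omega> $ i < v $ i) \<or> (\<forall>i. v $ i < X \<omega> $ i)"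
      using that(1) assms(9) unfolding F_def
      by (intro comonotonic_separation[OF X \<open>comonotonic M X\<close>]) blast+
  qed (use that in auto)
  have "F i 0 = 0" for i
  proof -
    have "prob {\<omega> \<in> space M. X \<omega> $ i \<le> 0} = prob {}"
      by (rule finite_measure_eq_AE) (use assms(7)[of i] in auto)
    then show ?thesis
      by (simp add: F_def cdf_law)
  qed
  moreover have "strict_mono_on {0..u} (F i)" for i
    unfolding F_def by (rule cdf_law_strict_mono_on[OF comp assms(11)])
  moreover have "continuous_on {0..u} (F i)" for i
    using assms(9) by (rule continuous_on_subset) simp
  ultimately obtain v where v: "v \<in> ?E"
    using equal_level_allocation[of u F 0] \<open>u > 0\<close> by (smt (verit) mem_Collect_eq)
  \<comment> \<open>Every element of the set is the unique minimiser of one and the same function.\<close>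
  have "w = v" if "w \<in> ?E" for w
    using optimal[OF that, of UNIV] optimal[OF v, of UNIV] by simp
  with v have "?E = {v}"
    by blast
  then show ?thesis
    using optimal[OF v, of "{..u}"] optimal[OF v, of "{u..}"] optimal[OF v, of UNIV]
    by (simp add: indicator_I_eq indicator_J_eq indicator_loc_eq subset_iff)
qed

end
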